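(* Let $F_i$ denote the Fibonacci numbers ($F_1=F_2=1$, $F_i=F_{i-1}+F_{i-2}$ for $i\ge 3$). For an integer $n$ and $k\ge 1$, a representation of $n$ of length $k$ is a sequence $(a_k,a_{k-1},\dots,a_1)\in\{-1,0,1\}^k$ with $\sum_{i=1}^k a_iF_i=n$, and $B(n;k)$ is the number of such representations. Say such a representation starts with $(b_1,\dots,b_r)$ (where $r\le k$) if $a_{k-i+1}=b_i$ for $1\le i\le r$. Let $f(n;k)$ be the number of representations of $n$ of length $k$ starting with $(1,0)$, $(1,1)$, $(-1,0)$, $(-1,-1)$, $(1,-1,1)$, or $(-1,1,-1)$. Then for every integer $n$, \[ B(n;k+1)=B(n;k)+B(n;k-1)+B(n;k-2)+f(n;k+1)\qquad\text{for all } k\ge 3. \] Moreover, there exists a function $f$ on the integers such that for every fixed integer $n$, $f(n;k)=f(n)$ for all sufficiently large $k$ (where how large may depend on $n$).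
   Context: The digit $-1$ is sometimes written $T$. The length of a representation is $k$ even if its leading digit $a_k$ is $0$. Positions $F_1$ and $F_2$ are treated as distinct, so both may be used in one representation. *)

theory Defs
  imports Main "HOL-Number_Theory.Fib" "HOL-Library.FuncSet"
begin

(* A representation (a_k, ..., a_1) is the extensional function i |-> a_i on {1..k},
   i.e. a i is the digit at position i and a k is the leading digit (possibly 0). *)
definition representations :: "int \<Rightarrow> nat \<Rightarrow> (nat \<Rightarrow> int) set" where
  "representations n k =
     {a \<in> {1..k} \<rightarrow>\<^sub>E {-1, 0, 1}. (\<Sum>i=1..k. a i * int (fib i)) = n}"

definition B :: "int \<Rightarrow> nat \<Rightarrow> nat" where
  "B n k = card (representations n k)"

(* The list bs = [b_1, ..., b_r] is indexed from 0, so b_i is bs ! (i - 1). *)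
definition starts_with :: "nat \<Rightarrow> (nat \<Rightarrow> int) \<Rightarrow> int list \<Rightarrow> bool" where
  "starts_with k a bs \<longleftrightarrow>
     length bs \<le> k \<and> (\<forall>i\<in>{1..length bs}. a (k - i + 1) = bs ! (i - 1))"

definition f :: "int \<Rightarrow> nat \<Rightarrow> nat" where
  "f n k = card {a \<in> representations n k.
     \<exists>bs \<in> {[1, 0], [1, 1], [-1, 0], [-1, -1], [1, -1, 1], [-1, 1, -1]}. starts_with k a bs}"

end

(* Prescribing the leading digits reduces every count to a value of B, since the remaining digits
   represent a shifted integer.  The recurrence is then F_{k+1} - F_k = F_{k-1}, applied to the
   representations that start with (1,-1) or (-1,1).  For the second claim, the digits below
   position k sum to at most F_{k+1} - 1 in absolute value, so for large k the starts (1,1) and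
   (1,-1,1) are impossible and (1,0) must be followed by -1; as F_{k+1} - F_{k-1} = F_k, replacing
   (1,0,-1) by (1,0) then matches lengths k + 1 and k.  The negated starts behave in the same way. *)
theory Submission
  imports Defs
begin

lemma starts_with_Nil [simp]: "starts_with k a []"
  by (simp add: starts_with_def)

text \<open>Turns the positional definition into a recursion on the list, so that the simplifier can
  peel off leading digits and refute incompatible starts.\<close>

lemma starts_with_Cons [simp]:
  "starts_with (Suc k) a (d # bs) \<longleftrightarrow> a (Suc k) = d \<and> starts_with k a bs"
proof -
  have "(\<forall>i\<in>{1..Suc m}. P i) \<longleftrightarrow> P 1 \<and> (\<forall>i\<in>{1..m}. P (Suc i))" for P and m :: nat
  proof -
    have "{1..Suc m} = insert 1 (Suc ` {1..m})"
      by (auto simp: image_Suc_atLeastAtMost)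
    then show ?thesis
      by (simp only: ball_simps)
  qed
  moreover have "(d # bs) ! (Suc i - 1) = bs ! (i - 1)" and "Suc k - Suc i + 1 = k - i + 1"
    if "i \<in> {1..length bs}" for i
    using that by (auto simp: nth_Cons')
  ultimately show ?thesis
    by (auto simp: starts_with_def)
qed

lemma starts_with_fun_upd_Suc [simp]:
  "starts_with k (a(Suc k := x)) bs \<longleftrightarrow> starts_with k a bs"
  unfolding starts_with_def by (intro conj_cong refl ball_cong) auto

lemma finite_representations [simp]: "finite (representations n k)"
proof -
  have "finite ({1..k} \<rightarrow>\<^sub>E {-1, 0, 1 :: int})"
    by (intro finite_PiE) auto
  then show ?thesis
    by (simp add: representations_def)
qed

definition prefix_count :: "int \<Rightarrow> nat \<Rightarrow> int list \<Rightarrow> nat" where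
  "prefix_count n k bs = card {a \<in> representations n k. starts_with k a bs}"

lemma prefix_count_Nil [simp]: "prefix_count n k [] = B n k"
  by (simp add: prefix_count_def B_def)

lemma sum_fun_upd_Suc:
  "(\<Sum>i=1..k. (a(Suc k := x)) i * c i) = (\<Sum>i=1..k. a i * (c i :: int))"
  by (rule sum.cong) auto

text \<open>Deleting the leading digit is a bijection. The deleted position is reset to
  \<open>undefined\<close> because representations are extensional functions.\<close>

lemma prefix_count_Cons:
  assumes d: "d \<in> {-1, 0, 1}"
  shows "prefix_count n (Suc k) (d # bs) = prefix_count (n - d * int (fib (Suc k))) k bs"
  unfolding prefix_count_def
proof (rule bij_betw_same_card,
    rule bij_betw_byWitness[where f = "\<lambda>a. a(Suc k := undefined)" and f' = "\<lambda>a. a(Suc k := d)"])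
  let ?X = "{a \<in> representations n (Suc k). starts_with (Suc k) a (d # bs)}"
  let ?Y = "{a \<in> representations (n - d * int (fib (Suc k))) k. starts_with k a bs}"
  let ?drop = "\<lambda>a :: nat \<Rightarrow> int. a(Suc k := undefined)"
  let ?add = "\<lambda>a :: nat \<Rightarrow> int. a(Suc k := d)"
  show "\<forall>a\<in>?X. ?add (?drop a) = a"
    by auto
  show "\<forall>a\<in>?Y. ?drop (?add a) = a"
    by (auto simp: representations_def fun_eq_iff PiE_iff extensional_def)
  show "?drop ` ?X \<subseteq> ?Y"
    by (auto simp: representations_def PiE_iff sum_fun_upd_Suc extensional_def)
  show "?add ` ?Y \<subseteq> ?X"
    using d by (auto simp: representations_def PiE_iff sum_fun_upd_Suc extensional_def Ball_def le_Suc_eq)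
qed

lemma B_Suc:
  "B n (Suc k) = B n k + B (n - int (fib (Suc k))) k + B (n + int (fib (Suc k))) k"
proof -
  let ?S = "\<lambda>d. {a \<in> representations n (Suc k). starts_with (Suc k) a [d]}"
  have "representations n (Suc k) = ?S 0 \<union> ?S 1 \<union> ?S (-1)"
    by (auto simp: representations_def PiE_iff)
  then have "B n (Suc k) = card (?S 0 \<union> ?S 1 \<union> ?S (-1))"
    by (simp add: B_def)
  also have "\<dots> = card (?S 0) + card (?S 1) + card (?S (-1))"
    by (subst card_Un_disjoint; auto)+
  also have "\<dots> = prefix_count n (Suc k) [0] + prefix_count n (Suc k) [1] + prefix_count n (Suc k) [-1]"
    by (simp only: prefix_count_def)
  also have "\<dots> = B n k + B (n - int (fib (Suc k))) k + B (n + int (fib (Suc k))) k"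
    by (simp add: prefix_count_Cons del: fib.simps)
  finally show ?thesis .
qed

lemma f_eq_sum_prefix_count:
  "f n (Suc (Suc (Suc k))) =
     (\<Sum>bs\<in>{[1, 0], [1, 1], [-1, 0], [-1, -1], [1, -1, 1], [-1, 1, -1]}.
        prefix_count n (Suc (Suc (Suc k))) bs)"
proof -
  let ?K = "Suc (Suc (Suc k))"
  let ?P = "{[1, 0], [1, 1], [-1, 0], [-1, -1], [1, -1, 1], [-1, 1, -1]} :: int list set"
  have "f n ?K = card (\<Union>bs\<in>?P. {a \<in> representations n ?K. starts_with ?K a bs})"
    unfolding f_def by (rule arg_cong[where f = card]) blast
  also have "\<dots> = (\<Sum>bs\<in>?P. prefix_count n ?K bs)"
    unfolding prefix_count_def by (rule card_UN_disjoint) auto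
  finally show ?thesis .
qed

text \<open>The factor 2 comes from the starts of length three: F_{k+3} - F_{k+2} + F_{k+1} = 2
  F_{k+1}.\<close>

lemma f_eq:
  "f n (Suc (Suc (Suc k))) =
     B (n - int (fib (k + 3))) (Suc k) + B (n + int (fib (k + 3))) (Suc k)
   + B (n - int (fib (k + 3)) - int (fib (k + 2))) (Suc k)
   + B (n + int (fib (k + 3)) + int (fib (k + 2))) (Suc k)
   + B (n - 2 * int (fib (k + 1))) k + B (n + 2 * int (fib (k + 1))) k"
  unfolding f_eq_sum_prefix_count
  by (simp add: prefix_count_Cons numeral_3_eq_3 algebra_simps)

lemma B_recurrence:
  assumes "k \<ge> 3"
  shows "B n (k + 1) = B n k + B n (k - 1) + B n (k - 2) + f n (k + 1)"
proof -
  obtain j where k: "k = Suc (Suc j)"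
    using assms by (metis add_2_eq_Suc le_Suc_ex Suc_le_D numeral_3_eq_3 Suc_le_mono)
  show ?thesis
    \<comment> \<open>The starts (1,-1) and (-1,1) leave n - F_{j+1} and n + F_{j+1} at length j+1.
      Splitting both once more gives \<open>B n j\<close> twice; one copy combines with the terms of
      leading digit 0 into \<open>B n (Suc j)\<close>.\<close>
    unfolding k
    by (simp add: f_eq B_Suc[of _ "Suc (Suc j)"] B_Suc[of "_ - _" "Suc j"] B_Suc[of "_ + _" "Suc j"]
        B_Suc[of _ j] numeral_3_eq_3 algebra_simps)
qed

text \<open>The largest possible sum is F_1 + ... + F_k = F_{k+2} - 1. In the induction a leading
  digit changes n by at most F_{k+1} = F_{k+3} - F_{k+2}.\<close>

lemma B_eq_0:
  assumes "\<bar>n\<bar> \<ge> int (fib (k + 2))"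
  shows "B n k = 0"
  using assms
proof (induction k arbitrary: n)
  case 0
  then show ?case
    by (auto simp: B_def representations_def)
next
  case (Suc k)
  then show ?case
    by (auto simp: B_Suc intro!: Suc.IH)
qed

text \<open>A crude growth bound that makes the threshold for k explicit in n.\<close>

lemma le_fib_add_2: "n \<le> fib (n + 2)"
proof (induction n)
  case (Suc n)
  have "fib (Suc n) > 0"
    by (simp add: fib_neq_0_nat)
  with Suc show ?case
    by simp
qed simp

lemma f_Suc_eq:
  assumes "k \<ge> nat \<bar>n\<bar> + 6"
  shows "f n (Suc k) = f n k"
proof -
  obtain j where k: "k = Suc (Suc (Suc (Suc j)))" and j: "nat \<bar>n\<bar> + 2 \<le> j"
    using assms by (auto simp: le_iff_add)
  have n: "\<bar>n\<bar> \<le> int (fib j)"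
    using le_fib_add_2[of "j - 2"] j by (simp add: le_add_diff_inverse2 del: add_2_eq_Suc' fib.simps)
  have mono: "fib j \<le> fib (Suc j)"
    by (rule fib_Suc_mono)
  have pos: "fib j > 0"
    using j by (simp add: fib_neq_0_nat)
  \<comment> \<open>The tight case is the start (1,-1,1) or its negation at i = j+1: 2 F_{i+1} -
    F_{i+2} = F_{i-1} = F_j, which still bounds the absolute value of n.\<close>
  have f: "f n (Suc (Suc (Suc i))) = B (n - int (fib (i + 3))) (Suc i) + B (n + int (fib (i + 3))) (Suc i)"
    if "i = Suc j \<or> i = Suc (Suc j)" for i
    using that n mono pos by (auto simp: f_eq eval_nat_numeral intro!: B_eq_0)
  have "B (n - int (fib (j + 5))) (Suc (Suc (Suc j))) = B (n - int (fib (j + 4))) (Suc (Suc j))"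
    and "B (n + int (fib (j + 5))) (Suc (Suc (Suc j))) = B (n + int (fib (j + 4))) (Suc (Suc j))"
    using n mono pos
    by (auto simp: B_Suc[of _ "Suc (Suc j)"] B_eq_0 eval_nat_numeral algebra_simps)
  then show ?thesis
    unfolding k by (simp add: f eval_nat_numeral del: fib.simps)
qed

theorem theorem1p2:
  shows "(\<forall>(n::int) (k::nat). k \<ge> 3 \<longrightarrow>
            B n (k + 1) = B n k + B n (k - 1) + B n (k - 2) + f n (k + 1)) \<and>
         (\<exists>g :: int \<Rightarrow> nat. \<forall>n. \<exists>K. \<forall>k \<ge> K. f n k = g n)"
proof (intro conjI allI impI exI)
  fix n :: int and k :: nat
  assume "k \<ge> 3"
  then show "B n (k + 1) = B n k + B n (k - 1) + B n (k - 2) + f n (k + 1)"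
    by (rule B_recurrence)
next
  fix n :: int and k :: nat
  \<comment> \<open>The witnesses left schematic by \<open>exI\<close> are fixed here: K is the
    threshold of \<open>f_Suc_eq\<close>, and g takes the value of \<open>f\<close> at K.\<close>
  assume "k \<ge> nat \<bar>n\<bar> + 6"
  then show "f n k = f n (nat \<bar>n\<bar> + 6)"
    by (induction k rule: dec_induct) (simp_all add: f_Suc_eq)
qed

end
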